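(* Let $G$ be a connected $P_5$-free chordal bipartite graph with bipartition $(A,B)$, let $(A_1,B_1)$ be a maximum biclique of $G$ with $A_1\subseteq A$, $B_1\subseteq B$, and suppose $A_2=A\setminus A_1$ and $B_2=B\setminus B_1$ are both nonempty. If $G$ is Hamiltonian, then $\overline{G}$ is Hamiltonian.
   Context: Graphs are finite, simple and undirected. A bipartite graph is chordal bipartite if every cycle of length at least six has a chord. $P_5$-free means no induced path on five vertices. The complement $\overline{G}$ has vertex set $V(G)$ and edge set $\{\{u,v\}: u\ne v,\ \{u,v\}\notin E(G)\}$. A biclique is a pair $(X,Y)$ with $X\subseteq A$, $Y\subseteq B$ such that every vertex of $X$ is adjacent to every vertex of $Y$; it is maximal if no vertex can be added to $X$ or to $Y$ keeping this property; following the paper, a maximum biclique is a maximal biclique $(X,Y)$ for which $\bigl||X|-|Y|\bigr|$ is minimum. *)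

theory Defs
  imports Main
begin

record 'a ugraph =
  verts :: "'a set"
  edges :: "'a set set"

definition simple_graph :: "'a ugraph \<Rightarrow> bool" where
  "simple_graph G \<longleftrightarrow> finite (verts G) \<and>
     (\<forall>e\<in>edges G. \<exists>u v. u \<in> verts G \<and> v \<in> verts G \<and> u \<noteq> v \<and> e = {u, v})"

definition complement :: "'a ugraph \<Rightarrow> 'a ugraph" where
  "complement G = \<lparr> verts = verts G,
     edges = {{u, v} | u v. u \<in> verts G \<and> v \<in> verts G \<and> u \<noteq> v \<and> {u, v} \<notin> edges G} \<rparr>"

definition is_walk :: "'a ugraph \<Rightarrow> 'a list \<Rightarrow> bool" where
  "is_walk G p \<longleftrightarrow> p \<noteq> [] \<and> set p \<subseteq> verts G \<and>
     (\<forall>i. Suc i < length p \<longrightarrow> {p ! i, p ! Suc i} \<in> edges G)"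

definition connected_graph :: "'a ugraph \<Rightarrow> bool" where
  "connected_graph G \<longleftrightarrow> verts G \<noteq> {} \<and>
     (\<forall>u\<in>verts G. \<forall>v\<in>verts G. \<exists>p. is_walk G p \<and> hd p = u \<and> last p = v)"

text \<open>A cycle is given by the list of its vertices, each occurring once; the last vertex is
  adjacent to the first, and this closing edge is not repeated in the list.\<close>

definition is_cycle :: "'a ugraph \<Rightarrow> 'a list \<Rightarrow> bool" where
  "is_cycle G c \<longleftrightarrow> 3 \<le> length c \<and> distinct c \<and> is_walk G c \<and> {last c, hd c} \<in> edges G"

definition hamiltonian :: "'a ugraph \<Rightarrow> bool" where
  "hamiltonian G \<longleftrightarrow> (\<exists>c. is_cycle G c \<and> set c = verts G)"

text \<open>The two index conditions say that the positions \<open>i\<close> and \<open>j\<close> are not cyclically consecutive.\<close>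

definition has_chord :: "'a ugraph \<Rightarrow> 'a list \<Rightarrow> bool" where
  "has_chord G c \<longleftrightarrow> (\<exists>i j. i < j \<and> j < length c \<and> j \<noteq> Suc i \<and>
     \<not> (i = 0 \<and> j = length c - 1) \<and> {c ! i, c ! j} \<in> edges G)"

definition bipartition :: "'a ugraph \<Rightarrow> 'a set \<Rightarrow> 'a set \<Rightarrow> bool" where
  "bipartition G A B \<longleftrightarrow> A \<union> B = verts G \<and> A \<inter> B = {} \<and>
     (\<forall>e\<in>edges G. \<exists>a\<in>A. \<exists>b\<in>B. e = {a, b})"

definition bipartite :: "'a ugraph \<Rightarrow> bool" where
  "bipartite G \<longleftrightarrow> (\<exists>A B. bipartition G A B)"

definition chordal_bipartite :: "'a ugraph \<Rightarrow> bool" where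
  "chordal_bipartite G \<longleftrightarrow> bipartite G \<and> (\<forall>c. is_cycle G c \<and> 6 \<le> length c \<longrightarrow> has_chord G c)"

definition induced_path :: "'a ugraph \<Rightarrow> 'a list \<Rightarrow> bool" where
  "induced_path G p \<longleftrightarrow> distinct p \<and> is_walk G p \<and>
     (\<forall>i j. i < j \<and> j < length p \<and> {p ! i, p ! j} \<in> edges G \<longrightarrow> j = Suc i)"

definition P5_free :: "'a ugraph \<Rightarrow> bool" where
  "P5_free G \<longleftrightarrow> \<not> (\<exists>p. induced_path G p \<and> length p = 5)"

definition biclique :: "'a ugraph \<Rightarrow> 'a set \<Rightarrow> 'a set \<Rightarrow> 'a set \<Rightarrow> 'a set \<Rightarrow> bool" where
  "biclique G A B X Y \<longleftrightarrow> X \<subseteq> A \<and> Y \<subseteq> B \<and> (\<forall>x\<in>X. \<forall>y\<in>Y. {x, y} \<in> edges G)"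

definition maximal_biclique :: "'a ugraph \<Rightarrow> 'a set \<Rightarrow> 'a set \<Rightarrow> 'a set \<Rightarrow> 'a set \<Rightarrow> bool" where
  "maximal_biclique G A B X Y \<longleftrightarrow> biclique G A B X Y \<and>
     (\<forall>x\<in>A - X. \<not> biclique G A B (insert x X) Y) \<and>
     (\<forall>y\<in>B - Y. \<not> biclique G A B X (insert y Y))"

definition imbalance :: "'a set \<Rightarrow> 'a set \<Rightarrow> int" where
  "imbalance X Y = \<bar>int (card X) - int (card Y)\<bar>"

text \<open>``Maximum'' refers to balance here: among the maximal bicliques, the imbalance is least.
  It does not refer to the number of vertices or edges of the biclique.\<close>

definition maximum_biclique :: "'a ugraph \<Rightarrow> 'a set \<Rightarrow> 'a set \<Rightarrow> 'a set \<Rightarrow> 'a set \<Rightarrow> bool" where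
  "maximum_biclique G A B X Y \<longleftrightarrow> maximal_biclique G A B X Y \<and>
     (\<forall>X' Y'. maximal_biclique G A B X' Y' \<longrightarrow> imbalance X Y \<le> imbalance X' Y')"

end

(* In the complement both sides of the bipartition are cliques. By maximality of the biclique some
   a2 in A2 misses some b1 in B1 and some b2 in B2 misses some a1 in A1, so a2 b1 and b2 a1 are
   disjoint edges of the complement. They join a Hamiltonian path of A from a1 to a2 and one of B
   from b1 to b2 to a Hamiltonian cycle. *)
theory Submission
  imports Defs
begin

lemma is_walk_append:
  assumes "is_walk G p" "is_walk G q" "{last p, hd q} \<in> edges G"
  shows "is_walk G (p @ q)"
  unfolding is_walk_def
proof (intro conjI allI impI)
  show "p @ q \<noteq> []" "set (p @ q) \<subseteq> verts G"
    using assms unfolding is_walk_def by auto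
  fix i assume i: "Suc i < length (p @ q)"
  \<comment> \<open>The pair of consecutive positions lies inside \<open>p\<close>, straddles the
    junction, or lies inside \<open>q\<close>; the edge from \<open>last p\<close> to
    \<open>hd q\<close> serves the middle case.\<close>
  consider "Suc i < length p" | "Suc i = length p" | "length p \<le> i" by linarith
  then show "{(p @ q) ! i, (p @ q) ! Suc i} \<in> edges G"
  proof cases
    case 1
    then show ?thesis using assms(1) unfolding is_walk_def by (simp add: nth_append)
  next
    case 2
    have "p \<noteq> []" "q \<noteq> []" using assms unfolding is_walk_def by auto
    moreover have "i = length p - 1" using 2 by simp
    ultimately show ?thesis using assms(3) 2 by (simp add: nth_append last_conv_nth hd_conv_nth)
  next
    case 3
    then show ?thesis
      using i assms(2) unfolding is_walk_def by (simp add: nth_append Suc_diff_le)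
  qed
qed

lemma distinct_imp_is_walk:
  assumes "p \<noteq> []" "distinct p" "set p \<subseteq> verts G"
    and clique: "\<And>x y. x \<in> set p \<Longrightarrow> y \<in> set p \<Longrightarrow> x \<noteq> y \<Longrightarrow> {x, y} \<in> edges G"
  shows "is_walk G p"
  unfolding is_walk_def
proof (intro conjI allI impI)
  fix i assume "Suc i < length p"
  then show "{p ! i, p ! Suc i} \<in> edges G"
    using assms(2) by (intro clique) (auto simp: nth_eq_iff_index_eq)
qed (use assms in auto)

lemma distinct_list_with_ends:
  assumes "finite S" "u \<in> S" "v \<in> S" "u \<noteq> v"
  obtains p where "distinct p" "set p = S" "p \<noteq> []" "hd p = u" "last p = v"
proof -
  \<comment> \<open>Both ends are taken out of \<open>S\<close> first, so that
    \<open>u # r @ [v]\<close> lists each element exactly once.\<close>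
  obtain r where "distinct r" "set r = S - {u, v}"
    using finite_distinct_list[of "S - {u, v}"] assms(1) by auto
  then show thesis
    using assms by (intro that[of "u # r @ [v]"]) auto
qed

text \<open>A clique can be traversed in any order, so the ends of each traversal may be prescribed.
  The edge from \<open>x2\<close> to \<open>y1\<close> links the two traversals and the edge from
  \<open>y2\<close> to \<open>x1\<close> closes the cycle.\<close>

lemma hamiltonian_two_cliques:
  assumes "finite X" "finite Y" "X \<inter> Y = {}" "X \<union> Y = verts H"
    and X: "\<And>x y. x \<in> X \<Longrightarrow> y \<in> X \<Longrightarrow> x \<noteq> y \<Longrightarrow> {x, y} \<in> edges H"
    and Y: "\<And>x y. x \<in> Y \<Longrightarrow> y \<in> Y \<Longrightarrow> x \<noteq> y \<Longrightarrow> {x, y} \<in> edges H"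
    and x: "x1 \<in> X" "x2 \<in> X" "x1 \<noteq> x2" and y: "y1 \<in> Y" "y2 \<in> Y" "y1 \<noteq> y2"
    and e: "{x2, y1} \<in> edges H" "{y2, x1} \<in> edges H"
  shows "hamiltonian H"
proof -
  obtain p where p: "distinct p" "set p = X" "p \<noteq> []" "hd p = x1" "last p = x2"
    using distinct_list_with_ends assms(1) x by metis
  obtain q where q: "distinct q" "set q = Y" "q \<noteq> []" "hd q = y1" "last q = y2"
    using distinct_list_with_ends assms(2) y by metis
  have "is_walk H p" "is_walk H q"
    using p q X Y assms(4) by (auto intro!: distinct_imp_is_walk)
  then have "is_walk H (p @ q)"
    using p q e by (simp add: is_walk_append)
  \<comment> \<open>Distinct ends force two entries in each list, so the joined list meets the bound
    of three in \<open>is_cycle\<close>.\<close>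
  moreover have "2 \<le> length p" "2 \<le> length q"
    using p x q y by (cases p; cases "tl p"; cases q; cases "tl q"; auto)+
  ultimately have "is_cycle H (p @ q)"
    using p q e assms(3) unfolding is_cycle_def by simp
  then show ?thesis
    using p q assms(4) unfolding hamiltonian_def by (intro exI[of _ "p @ q"]) auto
qed

theorem theorem17:
  fixes G :: "'a ugraph" and A B A1 B1 A2 B2 :: "'a set"
  assumes "simple_graph G"
    and "connected_graph G"
    and "P5_free G"
    and "chordal_bipartite G"
    and "bipartition G A B"
    and "maximum_biclique G A B A1 B1"
    and "A2 = A - A1"
    and "B2 = B - B1"
    and "A2 \<noteq> {}"
    and "B2 \<noteq> {}"
    and "hamiltonian G"
  shows "hamiltonian (complement G)"
proof -
  have AB: "A \<union> B = verts G" "A \<inter> B = {}"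
    and bip: "\<And>e. e \<in> edges G \<Longrightarrow> \<exists>a\<in>A. \<exists>b\<in>B. e = {a, b}"
    using assms(5) unfolding bipartition_def by auto
  have "finite (A \<union> B)" using assms(1) AB unfolding simple_graph_def by simp
  then have fin: "finite A" "finite B" by auto
  have bc: "biclique G A B A1 B1"
    and maxA: "\<And>x. x \<in> A - A1 \<Longrightarrow> \<not> biclique G A B (insert x A1) B1"
    and maxB: "\<And>y. y \<in> B - B1 \<Longrightarrow> \<not> biclique G A B A1 (insert y B1)"
    using assms(6) unfolding maximum_biclique_def maximal_biclique_def by auto
  obtain a2 where a2: "a2 \<in> A" "a2 \<notin> A1" using assms(7,9) by auto
  obtain b2 where b2: "b2 \<in> B" "b2 \<notin> B1" using assms(8,10) by auto
  \<comment> \<open>All pairs in \<open>A1\<close> and \<open>B1\<close> are already adjacent, so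
    inserting \<open>a2\<close> can fail only at a pair containing \<open>a2\<close>. The same
    argument for \<open>b2\<close> gives \<open>a1\<close>.\<close>
  obtain b1 where b1: "b1 \<in> B1" "{a2, b1} \<notin> edges G"
    using bc maxA[of a2] a2 unfolding biclique_def by auto
  obtain a1 where a1: "a1 \<in> A1" "{a1, b2} \<notin> edges G"
    using bc maxB[of b2] b2 unfolding biclique_def by auto
  have sub: "a1 \<in> A" "b1 \<in> B" using bc a1 b1 unfolding biclique_def by auto
  have compl: "{x, y} \<in> edges (complement G)"
    if "x \<in> verts G" "y \<in> verts G" "x \<noteq> y" "{x, y} \<notin> edges G" for x y
    using that unfolding complement_def by auto
  show ?thesis
  \<comment> \<open>The ends differ on each side because \<open>a1\<close> and \<open>b1\<close> lie
    in the biclique while \<open>a2\<close> and \<open>b2\<close> lie outside it.\<close>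
  proof (rule hamiltonian_two_cliques[OF fin AB(2), of _ a1 a2 b1 b2])
    show "A \<union> B = verts (complement G)" using AB by (simp add: complement_def)
    show "{x, y} \<in> edges (complement G)" if "x \<in> A" "y \<in> A" "x \<noteq> y" for x y
    proof (rule compl)
      \<comment> \<open>An edge of \<open>G\<close> inside \<open>A\<close> would need an end in
        \<open>B\<close>, contradicting disjointness.\<close>
      show "{x, y} \<notin> edges G" using bip[of "{x, y}"] that AB by (auto simp: doubleton_eq_iff)
    qed (use that AB in auto)
    show "{x, y} \<in> edges (complement G)" if "x \<in> B" "y \<in> B" "x \<noteq> y" for x y
    proof (rule compl)
      show "{x, y} \<notin> edges G" using bip[of "{x, y}"] that AB by (auto simp: doubleton_eq_iff)
    qed (use that AB in auto)
    show "{a2, b1} \<in> edges (complement G)"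
      using a2 b1 sub AB by (intro compl) auto
    show "{b2, a1} \<in> edges (complement G)"
      using b2 a1 sub AB by (intro compl) (auto simp: insert_commute)
  qed (use a1 a2 b1 b2 sub in auto)
qed

end
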